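(* Let $R$ be a commutative ring with identity in which $2$ is not a zero divisor, and let $N$ be any positive integer. An $R$-linear derivation $L$ of $R[X_1,\ldots,X_N]$ satisfies $L(X_1^2+\cdots+X_N^2) = 0$ if and only if $L$ is an $R[X_1,\ldots,X_N]$-linear combination of the operators $M_{jk}$, $j,k\in\{1,\ldots,N\}$, $j\ne k$.
   Context: $M_{jk} = X_j\partial_k - X_k\partial_j$ acting on $R[X_1,\ldots,X_N]$, where $\partial_j = \partial/\partial X_j$. For $N=1$ there are no such operators and the only linear combination is $0$. An element $a\in R$ is "not a zero divisor" if $ab=0$ with $b\in R$ implies $b=0$. *)

theory Defs
  imports "HOL-Library.Poly_Mapping"
begin

text \<open>
  The coefficient ring is a type of sort \<open>{comm_ring, comm_monoid_mult}\<close>, i.e. a commutative ring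
  with identity.  The class \<open>comm_ring_1\<close> is deliberately avoided, since its axiom \<open>0 \<noteq> 1\<close> would
  exclude the zero ring.  As a consequence numerals and \<open>of_nat\<close> on coefficients, and \<open>1\<close> and
  powers of polynomials, are not available, so \<open>2\<close>, integer multiples and squares are written out.

  An element of \<open>('n, 'a) polynomial\<close> maps an exponent vector \<open>'n \<Rightarrow>\<^sub>0 nat\<close> to its coefficient; for a
  finite type \<open>'n\<close> this is the polynomial ring in \<open>CARD('n)\<close> indeterminates, indexed by \<open>'n\<close>.
\<close>

type_synonym ('n, 'a) polynomial = "('n \<Rightarrow>\<^sub>0 nat) \<Rightarrow>\<^sub>0 'a"

definition Const :: "'a \<Rightarrow> ('n, 'a::{comm_ring, comm_monoid_mult}) polynomial" where
  "Const a = Poly_Mapping.single 0 a"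

definition X :: "'n \<Rightarrow> ('n, 'a::{comm_ring, comm_monoid_mult}) polynomial" where
  "X j = Poly_Mapping.single (Poly_Mapping.single j 1) 1"

text \<open>
  Termwise differentiation: the term with coefficient \<open>a\<close> and exponent vector \<open>m\<close> becomes the term
  with coefficient \<open>m\<^sub>j a\<close> (the \<open>m\<^sub>j\<close>-fold sum of \<open>a\<close>) and exponent vector \<open>m - e\<^sub>j\<close>.  If \<open>m\<^sub>j = 0\<close>,
  the truncated subtraction is harmless because the new coefficient is \<open>0\<close>.
\<close>

definition partial :: "'n \<Rightarrow> ('n, 'a::{comm_ring, comm_monoid_mult}) polynomial \<Rightarrow> ('n, 'a) polynomial" where
  "partial j p =
     (\<Sum>m\<in>Poly_Mapping.keys p.
        Poly_Mapping.single (m - Poly_Mapping.single j 1)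
          (\<Sum>i<Poly_Mapping.lookup m j. Poly_Mapping.lookup p m))"

lemma partial_single:
  "partial j (Poly_Mapping.single m a) =
     Poly_Mapping.single (m - Poly_Mapping.single j 1) (\<Sum>i<Poly_Mapping.lookup m j. a)"
  by (simp add: partial_def)

definition M :: "'n \<Rightarrow> 'n \<Rightarrow> ('n, 'a::{comm_ring, comm_monoid_mult}) polynomial \<Rightarrow> ('n, 'a) polynomial" where
  "M j k p = X j * partial k p - X k * partial j p"

definition linear_derivation ::
  "(('n, 'a::{comm_ring, comm_monoid_mult}) polynomial \<Rightarrow> ('n, 'a) polynomial) \<Rightarrow> bool" where
  "linear_derivation L \<longleftrightarrow>
     (\<forall>p q. L (p + q) = L p + L q) \<and>
     (\<forall>a p. L (Const a * p) = Const a * L p) \<and>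
     (\<forall>p q. L (p * q) = L p * q + p * L q)"

definition not_zero_divisor :: "'a::comm_ring \<Rightarrow> bool" where
  "not_zero_divisor a \<longleftrightarrow> (\<forall>b. a * b = 0 \<longrightarrow> b = 0)"

end

theory Submission
  imports Defs
begin

text \<open>
  A derivation \<open>L\<close> is \<open>\<Sum>k. L (X k) * partial k\<close>, so the left-hand side says that
  \<open>2 * (\<Sum>k. X k * L (X k)) = 0\<close>, and \<open>2\<close> can be cancelled.  Every linear relation
  \<open>\<Sum>k. X k * f k = 0\<close> is a combination of the Koszul relations, that is
  \<open>f k = (\<Sum>j. (c j k - c k j) * X j)\<close>; this holds over every commutative ring, by induction on
  the number of variables.  Such a \<open>c\<close> gives exactly the coefficients of the \<open>M j k\<close>.
\<close>

section \<open>Polynomials\<close>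

text \<open>Updating \<open>f\<close> at a key outside its support is the same as adding a single
  term, so the freshness conditions of \<open>update_induct\<close> disappear.\<close>

lemma poly_mapping_single_induct [case_names zero single_plus]:
  assumes "P 0"
    and "\<And>m a p. P p \<Longrightarrow> P (Poly_Mapping.single m a + p)"
  shows "P (p :: 'b \<Rightarrow>\<^sub>0 'c::comm_monoid_add)"
proof (induction p rule: update_induct)
  case const
  show ?case by fact
next
  case (update f a b)
  have "Poly_Mapping.update a b f = Poly_Mapping.single a b + f"
    using update.hyps(1)
    by (intro poly_mapping_eqI)
       (auto simp: lookup_add lookup_single lookup_update when_def in_keys_iff)
  with assms(2)[OF update.IH] show ?case by simp
qed

lemma X_times_single:
  "X j * Poly_Mapping.single m a = Poly_Mapping.single (Poly_Mapping.single j 1 + m) a"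
  by (simp add: X_def mult_single)

lemma Const_one_times [simp]: "Const 1 * p = p"
  by (induction p rule: poly_mapping_single_induct)
     (simp_all add: Const_def mult_single distrib_left)

lemma times_Const_one [simp]: "p * Const 1 = p"
  using Const_one_times[of p] by (simp only: mult.commute)

lemma polynomial_induct [case_names Const X_times plus]:
  fixes p :: "('n, 'a::{comm_ring, comm_monoid_mult}) polynomial"
  assumes Const: "\<And>a. P (Const a)"
    and X: "\<And>j p. P p \<Longrightarrow> P (X j * p)"
    and plus: "\<And>p q. P p \<Longrightarrow> P q \<Longrightarrow> P (p + q)"
  shows "P p"
proof -
  have step: "P (Poly_Mapping.single (Poly_Mapping.single j i + m) a)"
    if "P (Poly_Mapping.single m a)" for j i m and a :: 'a
  proof (induction i)
    case 0
    from that show ?case by simp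
  next
    case (Suc i)
    have "Poly_Mapping.single j (Suc i) = Poly_Mapping.single j 1 + Poly_Mapping.single j i"
      by (simp flip: single_add)
    with X[OF Suc, of j] show ?case by (simp add: X_times_single add.assoc)
  qed
  have single: "P (Poly_Mapping.single m a)" for m :: "'n \<Rightarrow>\<^sub>0 nat" and a
  \<comment> \<open>Exponent vectors are finitely supported maps too, so the same induction builds
    \<open>m\<close> up from powers of single variables.\<close>
  proof (induction m rule: poly_mapping_single_induct)
    case zero
    show ?case using Const[of a] by (simp add: Const_def)
  next
    case (single_plus j i m)
    then show ?case by (rule step)
  qed
  show ?thesis
  proof (induction p rule: poly_mapping_single_induct)
    case zero
    show ?case using Const[of 0] by (simp add: Const_def)
  next
    case (single_plus m a p)
    then show ?case by (intro plus single)
  qed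
qed

lemma lookup_X_times:
  "Poly_Mapping.lookup (X j * p) m =
     (if 0 < Poly_Mapping.lookup m j then Poly_Mapping.lookup p (m - Poly_Mapping.single j 1) else 0)"
proof (induction p rule: poly_mapping_single_induct)
  case zero
  show ?case by simp
next
  case (single_plus m' a p)
  \<comment> \<open>Positivity is essential: at exponent \<open>0\<close> the truncated subtraction
    returns \<open>m\<close> itself.\<close>
  have "Poly_Mapping.single j 1 + m' = m \<longleftrightarrow>
      0 < Poly_Mapping.lookup m j \<and> m' = m - Poly_Mapping.single j 1"
    by (auto simp: poly_mapping_eq_iff fun_eq_iff lookup_add lookup_minus lookup_single when_def
        split: if_splits)
  with single_plus show ?case
    by (auto simp: distrib_left X_times_single lookup_add lookup_single when_def)
qed

section \<open>Derivations\<close>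

text \<open>Extra keys carry coefficient \<open>0\<close>. This gives \<open>p\<close>,
  \<open>q\<close> and \<open>p + q\<close> a common index set, although cancellation may shrink the
  support of the sum.\<close>

lemma partial_superset:
  assumes "finite K" "Poly_Mapping.keys p \<subseteq> K"
  shows "partial j p = (\<Sum>m\<in>K. Poly_Mapping.single (m - Poly_Mapping.single j 1)
     (\<Sum>i<Poly_Mapping.lookup m j. Poly_Mapping.lookup p m))"
  unfolding partial_def using assms
  by (intro sum.mono_neutral_left) (auto simp: in_keys_iff)

lemma partial_add: "partial j (p + q) = partial j p + partial j q"
proof -
  let ?K = "Poly_Mapping.keys p \<union> Poly_Mapping.keys q"
  have "partial j p' = (\<Sum>m\<in>?K. Poly_Mapping.single (m - Poly_Mapping.single j 1)
     (\<Sum>i<Poly_Mapping.lookup m j. Poly_Mapping.lookup p' m))"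
    if "p' \<in> {p, q, p + q}" for p'
    using that keys_add[of p q] by (intro partial_superset) auto
  then show ?thesis
    by (simp add: lookup_add sum.distrib single_add)
qed

lemma partial_zero [simp]: "partial j 0 = 0"
  by (simp add: partial_def)

lemma partial_sum: "partial j (\<Sum>i\<in>I. f i) = (\<Sum>i\<in>I. partial j (f i))"
  by (induction I rule: infinite_finite_induct) (simp_all add: partial_add)

lemma partial_Const [simp]: "partial j (Const a) = 0"
  by (simp add: Const_def partial_single)

text \<open>On a monomial with \<open>j = k\<close>, raising the exponent by one adds one more copy
  of \<open>a\<close> to the repeated sum; this copy is the extra term of the product rule.\<close>

lemma partial_X_times:
  "partial k (X j * p) = (if j = k then p else 0) + X j * partial k p"
proof (induction p rule: poly_mapping_single_induct)
  case zero
  show ?case by simp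
next
  case (single_plus m a p)
  have "partial k (X j * Poly_Mapping.single m a) =
      (if j = k then Poly_Mapping.single m a else 0) + X j * partial k (Poly_Mapping.single m a)"
  proof (cases "j = k")
    case True
    show ?thesis
    \<comment> \<open>At exponent \<open>0\<close> the subtraction truncates, but its coefficient is
      an empty sum; at a positive exponent, multiplying by \<open>X k\<close> undoes it.\<close>
    proof (cases "Poly_Mapping.lookup m k")
      case 0
      with True show ?thesis
        by (simp add: X_times_single partial_single lookup_add)
    next
      case (Suc i)
      then have "Poly_Mapping.single k 1 + (m - Poly_Mapping.single k 1) = m"
        by (auto simp: poly_mapping_eq_iff fun_eq_iff lookup_add lookup_minus lookup_single when_def)
      with True show ?thesis
        by (simp add: X_times_single partial_single lookup_add single_add add.commute)
    qed
  next
    case False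
    show ?thesis
    proof (cases "Poly_Mapping.lookup m k")
      case 0
      with False show ?thesis
        by (simp add: X_times_single partial_single lookup_add lookup_single)
    next
      case (Suc i)
      with False have "Poly_Mapping.single j 1 + m - Poly_Mapping.single k 1 =
          Poly_Mapping.single j 1 + (m - Poly_Mapping.single k 1)"
        by (auto simp: poly_mapping_eq_iff fun_eq_iff lookup_add lookup_minus lookup_single when_def)
      with False show ?thesis
        by (simp add: X_times_single partial_single lookup_add lookup_single)
    qed
  qed
  with single_plus show ?case
    by (simp add: distrib_left partial_add)
qed

lemma partial_X: "partial k (X j) = (if j = k then Const 1 else 0)"
  using partial_X_times[of k j "Const 1"] by simp

text \<open>\<open>M j k\<close> is the infinitesimal rotation of a coordinate plane:
  \<open>X j * (X k + X k)\<close> and \<open>X k * (X j + X j)\<close> cancel.\<close>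

lemma M_sum_squares:
  "M j k (\<Sum>i\<in>UNIV. X i * X i :: ('n::finite, 'a::{comm_ring, comm_monoid_mult}) polynomial) = 0"
proof -
  have "partial k (\<Sum>i\<in>UNIV. X i * X i :: ('n, 'a) polynomial) = X k + X k" for k
    by (simp add: partial_sum partial_X_times partial_X sum.distrib if_distrib[of "(*) _"]
        cong: if_cong)
  then show ?thesis by (simp add: M_def algebra_simps)
qed

context
  fixes L :: "('n, 'a::{comm_ring, comm_monoid_mult}) polynomial \<Rightarrow> ('n, 'a) polynomial"
  assumes L: "linear_derivation L"
begin

lemma linear_derivation_add: "L (p + q) = L p + L q"
  using L by (simp add: linear_derivation_def)

lemma linear_derivation_mult: "L (p * q) = L p * q + p * L q"
  using L by (simp add: linear_derivation_def)

lemma linear_derivation_zero: "L 0 = 0"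
  using linear_derivation_add[of 0 0] by simp

lemma linear_derivation_sum: "L (\<Sum>i\<in>I. f i) = (\<Sum>i\<in>I. L (f i))"
  by (induction I rule: infinite_finite_induct)
     (simp_all add: linear_derivation_add linear_derivation_zero)

lemma linear_derivation_Const: "L (Const a) = 0"
proof -
  \<comment> \<open>The unit is idempotent, so its image equals twice itself and vanishes by
    additive cancellation.\<close>
  have "L (Const 1) = 0"
    using linear_derivation_mult[of "Const 1" "Const 1"] by simp
  moreover have "L (Const a * Const 1) = Const a * L (Const 1)"
    using L unfolding linear_derivation_def by blast
  ultimately show ?thesis by simp
qed

end

text \<open>Both sides are additive, kill constants and obey the same product rule for
  \<open>X j * p\<close>, with the same value at \<open>X j\<close>.\<close>

lemma linear_derivation_eq_sum_partial:
  fixes L :: "('n::finite, 'a::{comm_ring, comm_monoid_mult}) polynomial \<Rightarrow> ('n, 'a) polynomial"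
  assumes L: "linear_derivation L"
  shows "L p = (\<Sum>k\<in>UNIV. L (X k) * partial k p)"
proof (induction p rule: polynomial_induct)
  case (Const a)
  show ?case by (simp add: linear_derivation_Const[OF L])
next
  case (X_times j p)
  then show ?case
    by (simp add: linear_derivation_mult[OF L] partial_X_times distrib_left sum.distrib
        if_distrib[of "(*) _"] sum_distrib_left mult.left_commute cong: if_cong)
next
  case (plus p q)
  then show ?case
    by (simp add: linear_derivation_add[OF L] partial_add distrib_left sum.distrib)
qed

section \<open>Linear relations between the variables\<close>

text \<open>\<open>D p\<close> is the quotient of \<open>p\<close> by \<open>X t\<close>: the terms not divisible by \<open>X t\<close> are dropped.\<close>

lemma X_quotient_exists:
  obtains D :: "('n, 'a::{comm_ring, comm_monoid_mult}) polynomial \<Rightarrow> ('n, 'a) polynomial"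
  where "\<And>p q. D (p + q) = D p + D q"
    and "\<And>p. D (X t * p) = p"
    and "\<And>j p. j \<noteq> t \<Longrightarrow> D (X j * p) = X j * D p"
proof
  let ?e = "Poly_Mapping.single t (Suc 0)"
  \<comment> \<open>The coefficient of \<open>?D p\<close> at \<open>m\<close> is that of
    \<open>p\<close> at \<open>m + ?e\<close>.\<close>
  let ?D = "Poly_Mapping.map_key (\<lambda>m. m + ?e)"
  have inj: "inj (\<lambda>m. m + ?e)"
    by (simp add: inj_def)
  note lookup_D = map_key.rep_eq[OF inj] o_def
  show "?D (p + q) = ?D p + ?D q" for p q :: "('n, 'a) polynomial"
    by (rule map_key_plus[OF inj])
  show "?D (X t * p) = p" for p :: "('n, 'a) polynomial"
    by (rule poly_mapping_eqI) (simp add: lookup_D lookup_X_times lookup_add)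
  show "?D (X j * p) = X j * ?D p" if "j \<noteq> t" for j and p :: "('n, 'a) polynomial"
  proof (rule poly_mapping_eqI)
    fix m
    have "m + ?e - Poly_Mapping.single j 1 = m - Poly_Mapping.single j 1 + ?e"
      using that
      by (auto simp: poly_mapping_eq_iff fun_eq_iff lookup_add lookup_minus lookup_single when_def)
    with that show "Poly_Mapping.lookup (?D (X j * p)) m = Poly_Mapping.lookup (X j * ?D p) m"
      by (simp add: lookup_D lookup_X_times lookup_add lookup_single)
  qed
qed

text \<open>Applying \<open>D\<close> to the relation expresses \<open>f t\<close> through the
  \<open>D (f j)\<close>. Substituting this leaves a relation over \<open>S\<close> alone, with
  coefficients \<open>f j - X t * D (f j)\<close>. These may still involve any variable, so the
  induction runs over the index set with the polynomial ring fixed.\<close>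

lemma X_relation_Koszul:
  fixes f :: "'n \<Rightarrow> ('n, 'a::{comm_ring, comm_monoid_mult}) polynomial"
  assumes "finite S" "(\<Sum>j\<in>S. X j * f j) = 0"
  shows "\<exists>c. \<forall>k\<in>S. f k = (\<Sum>j\<in>S. (c j k - c k j) * X j)"
  using assms
proof (induction S arbitrary: f rule: finite_induct)
  case empty
  show ?case by simp
next
  case (insert t S)
  obtain D :: "('n, 'a) polynomial \<Rightarrow> ('n, 'a) polynomial" where
    D_add: "\<And>p q. D (p + q) = D p + D q" and
    D_t: "\<And>p. D (X t * p) = p" and
    D_X: "\<And>j p. j \<noteq> t \<Longrightarrow> D (X j * p) = X j * D p"
    by (rule X_quotient_exists[of t]) blast
  have D_0: "D 0 = 0"
    using D_add[of 0 0] by simp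
  have D_sum: "D (\<Sum>j\<in>I. g j) = (\<Sum>j\<in>I. D (g j))" for I and g :: "'n \<Rightarrow> _"
    by (induction I rule: infinite_finite_induct) (simp_all add: D_add D_0)
  from insert have rel: "X t * f t + (\<Sum>j\<in>S. X j * f j) = 0"
    by simp
  have "(\<Sum>j\<in>S. D (X j * f j)) = (\<Sum>j\<in>S. X j * D (f j))"
    using insert.hyps by (intro sum.cong D_X) auto
  with arg_cong[OF rel, of D] have ft: "f t + (\<Sum>j\<in>S. X j * D (f j)) = 0"
    by (simp add: D_add D_t D_sum D_0)
  have "(\<Sum>j\<in>S. X j * (f j - X t * D (f j))) =
      (\<Sum>j\<in>S. X j * f j) - X t * (\<Sum>j\<in>S. X j * D (f j))"
    by (simp add: right_diff_distrib sum_subtractf sum_distrib_left mult.left_commute)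
  also have "\<dots> = X t * f t + (\<Sum>j\<in>S. X j * f j) - X t * (f t + (\<Sum>j\<in>S. X j * D (f j)))"
    by (simp add: distrib_left)
  also have "\<dots> = 0"
    using rel ft by simp
  finally obtain c where c:
    "\<And>k. k \<in> S \<Longrightarrow> f k - X t * D (f k) = (\<Sum>j\<in>S. (c j k - c k j) * X j)"
    using insert.IH[of "\<lambda>k. f k - X t * D (f k)"] by blast
  \<comment> \<open>Entry \<open>(t, k)\<close> restores the subtracted
    \<open>X t * D (f k)\<close>. Antisymmetrizing puts \<open>- D (f j)\<close> into the formula
    for \<open>f t\<close>, as \<open>ft\<close> demands.\<close>
  define c' where
    "c' j k = (if k = t then 0 else if j = t then D (f k) else c j k)" for j k
  have "f k = (\<Sum>j\<in>insert t S. (c' j k - c' k j) * X j)" if "k \<in> insert t S" for k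
  proof (cases "k = t")
    case True
    have "(\<Sum>j\<in>S. (c' j t - c' t j) * X j) = (\<Sum>j\<in>S. - (X j * D (f j)))"
      using insert.hyps by (intro sum.cong) (auto simp: c'_def mult.commute)
    moreover from ft have "f t = - (\<Sum>j\<in>S. X j * D (f j))"
      by (simp add: eq_neg_iff_add_eq_0)
    ultimately show ?thesis
      using True insert.hyps by (simp add: sum_negf)
  next
    case False
    with that have "k \<in> S" by simp
    have "(\<Sum>j\<in>S. (c' j k - c' k j) * X j) = (\<Sum>j\<in>S. (c j k - c k j) * X j)"
      using insert.hyps False by (intro sum.cong) (auto simp: c'_def)
    moreover have "(c' t k - c' k t) * X t = X t * D (f k)"
      using False by (simp add: c'_def mult.commute)
    ultimately show ?thesis
      using c[OF \<open>k \<in> S\<close>] insert.hyps by (simp add: algebra_simps)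
  qed
  then show ?case by blast
qed

section \<open>Combinations of the operators \<open>M j k\<close> and the equivalence\<close>

lemma sum_off_diagonal_M:
  fixes c :: "'n::finite \<Rightarrow> 'n \<Rightarrow> ('n, 'a::{comm_ring, comm_monoid_mult}) polynomial"
  shows "(\<Sum>(j, k)\<in>{(j, k). j \<noteq> k}. c j k * M j k p) =
    (\<Sum>k\<in>UNIV. (\<Sum>j\<in>UNIV. (c j k - c k j) * X j) * partial k p)"
proof -
  \<comment> \<open>The diagonal may be added since \<open>M j j\<close> vanishes.\<close>
  have "(\<Sum>(j, k)\<in>{(j, k). j \<noteq> k}. c j k * M j k p) =
      (\<Sum>(j, k)\<in>UNIV \<times> UNIV. c j k * M j k p)"
    by (rule sum.mono_neutral_left) (auto simp: M_def)
  also have "\<dots> = (\<Sum>j\<in>UNIV. \<Sum>k\<in>UNIV. c j k * M j k p)"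
    by (simp add: sum.cartesian_product)
  also have "\<dots> = (\<Sum>j\<in>UNIV. \<Sum>k\<in>UNIV. c j k * X j * partial k p) -
      (\<Sum>j\<in>UNIV. \<Sum>k\<in>UNIV. c j k * X k * partial j p)"
    by (simp add: M_def right_diff_distrib sum_subtractf mult.assoc)
  \<comment> \<open>Swapping only this double sum makes the differentiation index the outer one in
    both.\<close>
  also have "(\<Sum>j\<in>UNIV. \<Sum>k\<in>UNIV. c j k * X j * partial k p) =
      (\<Sum>k\<in>UNIV. \<Sum>j\<in>UNIV. c j k * X j * partial k p)"
    by (rule sum.swap)
  finally show ?thesis
    by (simp add: sum_distrib_right left_diff_distrib sum_subtractf)
qed

text \<open>Doubling acts coefficientwise, so cancelling \<open>1 + 1\<close> passes from the
  coefficient ring to polynomials.\<close>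

lemma double_eq_zero_polynomial:
  fixes p :: "('n, 'a::{comm_ring, comm_monoid_mult}) polynomial"
  assumes "not_zero_divisor (1 + 1 :: 'a)" "p + p = 0"
  shows "p = 0"
proof (rule poly_mapping_eqI)
  fix m
  have "(1 + 1) * Poly_Mapping.lookup p m = Poly_Mapping.lookup (p + p) m"
    by (simp add: distrib_right lookup_add)
  with assms show "Poly_Mapping.lookup p m = Poly_Mapping.lookup 0 m"
    by (simp add: not_zero_divisor_def)
qed

theorem proposition2p5:
  fixes L :: "('n::finite, 'a::{comm_ring, comm_monoid_mult}) polynomial \<Rightarrow> ('n, 'a) polynomial"
  assumes "not_zero_divisor (1 + 1 :: 'a)"
    and "linear_derivation L"
  shows "L (\<Sum>j\<in>UNIV. X j * X j) = 0 \<longleftrightarrow>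
    (\<exists>c :: 'n \<Rightarrow> 'n \<Rightarrow> ('n, 'a) polynomial.
       \<forall>p. L p = (\<Sum>(j, k)\<in>{(j, k). j \<noteq> k}. c j k * M j k p))"
proof
  assume "L (\<Sum>j\<in>UNIV. X j * X j) = 0"
  then have "(\<Sum>j\<in>UNIV. X j * L (X j)) + (\<Sum>j\<in>UNIV. X j * L (X j)) = 0"
    by (simp add: linear_derivation_sum[OF assms(2)] linear_derivation_mult[OF assms(2)]
        sum.distrib mult.commute)
  then have "(\<Sum>j\<in>UNIV. X j * L (X j)) = 0"
    by (rule double_eq_zero_polynomial[OF assms(1)])
  then obtain c where "\<And>k. L (X k) = (\<Sum>j\<in>UNIV. (c j k - c k j) * X j)"
    using X_relation_Koszul[of UNIV "\<lambda>k. L (X k)"] by auto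
  then have "L p = (\<Sum>(j, k)\<in>{(j, k). j \<noteq> k}. c j k * M j k p)" for p
    using linear_derivation_eq_sum_partial[OF assms(2), of p] by (simp add: sum_off_diagonal_M)
  then show "\<exists>c. \<forall>p. L p = (\<Sum>(j, k)\<in>{(j, k). j \<noteq> k}. c j k * M j k p)"
    by blast
next
  assume "\<exists>c. \<forall>p. L p = (\<Sum>(j, k)\<in>{(j, k). j \<noteq> k}. c j k * M j k p)"
  then show "L (\<Sum>j\<in>UNIV. X j * X j) = 0"
    by (auto simp: M_sum_squares intro: sum.neutral)
qed

end
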